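(* Let $n$ be a positive integer and let $X = \mathrm{Cay}(\mathbb{Z}_n, S)$ be a circulant graph. Choose nontrivial subgroups $H$ and $K$ of $\mathbb{Z}_n$ such that $|K|$ is even, and let $K_o = K \setminus 2K$. Suppose that either (1) $S + H \subseteq S \cup (K_o + H)$ and $H \cap K_o = \emptyset$, or (2) $(S \setminus K_o) + H \subseteq S \cup K_o$, and either $|H| \neq 2$ or $|K|$ is divisible by $4$. Then $X$ is unstable.
   Context: All graphs are finite, simple and undirected. For an abelian group $G$ and a subset $S \subseteq G$ with $-S = S$ and $0 \notin S$, the Cayley graph $\mathrm{Cay}(G,S)$ has vertex set $G$, with $v$ adjacent to $w$ iff $w - v \in S$. A circulant graph is a Cayley graph on $\mathbb{Z}_n$. For $A \subseteq \mathbb{Z}_n$ and $g \in \mathbb{Z}_n$, $A + H = \{a + h : a \in A, h \in H\}$ and $2K = \{2k : k \in K\}$. The canonical bipartite double cover $BX$ of a graph $X$ has vertex set $V(X) \times \{0,1\}$, with $(v,0)$ adjacent to $(w,1)$ iff $v$ is adjacent to $w$ in $X$ (and no other edges). The group $\mathrm{Aut}\,X \times S_2$ (with $S_2$ the symmetric group on $\{0,1\}$) acts on $BX$ by $(\varphi,\sigma)(v,i) = (\varphi(v), \sigma(i))$, and so is a subgroup of $\mathrm{Aut}\,BX$. A graph $X$ is unstable if $\mathrm{Aut}\,BX \neq \mathrm{Aut}\,X \times S_2$. *)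

theory Defs
  imports
    "HOL-Algebra.Bij"
    "HOL-Algebra.Coset"
    "HOL-Algebra.Elementary_Groups"
    "Graph_Theory.Pair_Digraph"
begin

text \<open>
  Graphs are elements of \<^typ>\<open>'a pair_pre_digraph\<close> satisfying the predicate
  \<^const>\<open>pair_graph\<close>: finite vertex set, symmetric arc relation, no loops.
  Abelian groups are written multiplicatively, as in HOL-Algebra, so a difference
  \<open>w - v\<close> reads \<open>w \<otimes> inv v\<close>, a sum of sets is \<open><#>\<close>, and \<open>2 k\<close> is \<open>k [^] 2\<close>.
  The group of integers modulo \<open>n\<close> is \<^term>\<open>integer_mod_group n\<close>, with carrier
  \<open>{0..<n}\<close> for \<open>n > 0\<close>.
\<close>

definition connection_set :: "('a, 'b) monoid_scheme \<Rightarrow> 'a set \<Rightarrow> bool" where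
  "connection_set G S \<longleftrightarrow>
     S \<subseteq> carrier G \<and> (\<lambda>s. inv\<^bsub>G\<^esub> s) ` S = S \<and> \<one>\<^bsub>G\<^esub> \<notin> S"

definition Cay :: "('a, 'b) monoid_scheme \<Rightarrow> 'a set \<Rightarrow> 'a pair_pre_digraph" where
  "Cay G S = \<lparr>pverts = carrier G,
     parcs = {(v, w). v \<in> carrier G \<and> w \<in> carrier G \<and> w \<otimes>\<^bsub>G\<^esub> inv\<^bsub>G\<^esub> v \<in> S}\<rparr>"

definition bipartite_double_cover :: "'a pair_pre_digraph \<Rightarrow> ('a \<times> nat) pair_pre_digraph" where
  "bipartite_double_cover X = \<lparr>pverts = pverts X \<times> {0, 1},
     parcs = {((v, 0), (w, 1)) | v w. (v, w) \<in> parcs X}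
           \<union> {((w, 1), (v, 0)) | v w. (v, w) \<in> parcs X}\<rparr>"

text \<open>
  As in \<^const>\<open>BijGroup\<close>, automorphisms are extensional functions (\<open>undefined\<close> outside
  the vertex set), so that distinct functions are distinct permutations of the vertices.
\<close>

definition graph_Aut :: "'a pair_pre_digraph \<Rightarrow> ('a \<Rightarrow> 'a) monoid" where
  "graph_Aut X = BijGroup (pverts X) \<lparr>carrier := {f \<in> Bij (pverts X).
     \<forall>v \<in> pverts X. \<forall>w \<in> pverts X. (f v, f w) \<in> parcs X \<longleftrightarrow> (v, w) \<in> parcs X}\<rparr>"

definition cover_action ::
    "'a pair_pre_digraph \<Rightarrow> ('a \<Rightarrow> 'a) \<times> (nat \<Rightarrow> nat) \<Rightarrow> 'a \<times> nat \<Rightarrow> 'a \<times> nat" where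
  "cover_action X = (\<lambda>(\<phi>, \<sigma>). \<lambda>(v, i) \<in> pverts X \<times> {0, 1}. (\<phi> v, \<sigma> i))"

text \<open>
  \<open>Aut X \<times> S\<^sub>2\<close> is regarded as a subgroup of \<open>Aut BX\<close> through its action; see
  \<open>cover_action_hom\<close> and \<open>cover_action_inj\<close> below.
\<close>

definition unstable :: "'a pair_pre_digraph \<Rightarrow> bool" where
  "unstable X \<longleftrightarrow>
     carrier (graph_Aut (bipartite_double_cover X))
       \<noteq> cover_action X ` carrier (graph_Aut X \<times>\<times> BijGroup {0, 1})"

text \<open>The set \<open>K\<^sub>o = K - 2K\<close>.\<close>

definition nondoubles :: "('a, 'b) monoid_scheme \<Rightarrow> 'a set \<Rightarrow> 'a set" where
  "nondoubles G K = K - {k [^]\<^bsub>G\<^esub> (2::nat) | k. k \<in> K}"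


lemma pair_graph_Cay:
  assumes "comm_group G" "finite (carrier G)" "connection_set G S"
  shows "pair_graph (Cay G S)"
proof -
  interpret comm_group G by fact
  have sym: "v \<otimes>\<^bsub>G\<^esub> inv\<^bsub>G\<^esub> w \<in> S"
    if "v \<in> carrier G" "w \<in> carrier G" "w \<otimes>\<^bsub>G\<^esub> inv\<^bsub>G\<^esub> v \<in> S" for v w
  proof -
    have "inv\<^bsub>G\<^esub> (w \<otimes>\<^bsub>G\<^esub> inv\<^bsub>G\<^esub> v) \<in> S"
      using that assms(3) unfolding connection_set_def by blast
    then show ?thesis using that by (simp add: inv_mult_group)
  qed
  have "finite (parcs (Cay G S))"
    by (rule finite_subset[of _ "carrier G \<times> carrier G"]) (auto simp: Cay_def assms)
  then show ?thesis
    using assms sym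
    by unfold_locales (auto simp: Cay_def connection_set_def symmetric_def sym_def)
qed

lemma pair_graph_bipartite_double_cover:
  assumes "pair_graph X"
  shows "pair_graph (bipartite_double_cover X)"
proof -
  interpret pair_graph X by fact
  have "finite (parcs (bipartite_double_cover X))"
    by (rule finite_subset[of _ "(pverts X \<times> {0,1}) \<times> (pverts X \<times> {0,1})"])
      (auto simp: bipartite_double_cover_def dest: in_arcsD1 in_arcsD2)
  then show ?thesis
    by unfold_locales
      (auto simp: bipartite_double_cover_def symmetric_def sym_def dest: in_arcsD1 in_arcsD2)
qed

lemma carrier_graph_Aut:
  "f \<in> carrier (graph_Aut X) \<longleftrightarrow> f \<in> Bij (pverts X) \<and>
    (\<forall>v \<in> pverts X. \<forall>w \<in> pverts X. (f v, f w) \<in> parcs X \<longleftrightarrow> (v, w) \<in> parcs X)"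
  by (simp add: graph_Aut_def)

lemma group_graph_Aut: "group (graph_Aut X)"
proof -
  let ?V = "pverts X"
  let ?A = "carrier (graph_Aut X)"
  have "subgroup ?A (BijGroup ?V)"
  proof (rule subgroup.intro)
    show "?A \<subseteq> carrier (BijGroup ?V)"
      by (auto simp: carrier_graph_Aut BijGroup_def)
    show "\<one>\<^bsub>BijGroup ?V\<^esub> \<in> ?A"
      by (simp add: carrier_graph_Aut BijGroup_def id_Bij)
  next
    fix f g assume "f \<in> ?A" "g \<in> ?A"
    then show "f \<otimes>\<^bsub>BijGroup ?V\<^esub> g \<in> ?A"
      using Bij_imp_funcset[of g ?V]
      by (auto simp: carrier_graph_Aut BijGroup_def compose_Bij compose_eq Pi_iff)
  next
    fix f assume f: "f \<in> ?A"
    then have B: "f \<in> Bij ?V" by (simp add: carrier_graph_Aut)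
    then have bb: "bij_betw f ?V ?V" by (simp add: Bij_def)
    have iv: "inv_into ?V f v \<in> ?V" "f (inv_into ?V f v) = v" if "v \<in> ?V" for v
      using Bij_inv_into_mem[OF B that] bij_betw_inv_into_right[OF bb that] by auto
    have "(inv_into ?V f v, inv_into ?V f w) \<in> parcs X \<longleftrightarrow> (v, w) \<in> parcs X"
      if "v \<in> ?V" "w \<in> ?V" for v w
      using f iv[OF that(1)] iv[OF that(2)] unfolding carrier_graph_Aut by metis
    then show "inv\<^bsub>BijGroup ?V\<^esub> f \<in> ?A"
      using B by (simp add: carrier_graph_Aut inv_BijGroup restrict_inv_into_Bij)
  qed
  then have "group (BijGroup ?V \<lparr>carrier := ?A\<rparr>)"
    by (rule subgroup.subgroup_is_group[OF _ group_BijGroup])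
  then show ?thesis by (simp add: graph_Aut_def)
qed

lemma Bij_01_cases:
  assumes "\<sigma> \<in> Bij {0, 1::nat}"
  shows "\<sigma> 0 = 0 \<and> \<sigma> 1 = 1 \<or> \<sigma> 0 = 1 \<and> \<sigma> 1 = 0"
proof -
  have "bij_betw \<sigma> {0, 1} {0, 1}" using assms by (simp add: Bij_def)
  then have "\<sigma> 0 \<in> {0, 1}" "\<sigma> 1 \<in> {0, 1}" "\<sigma> 0 \<noteq> \<sigma> 1"
    by (auto simp: bij_betw_def inj_on_def)
  then show ?thesis by auto
qed

lemma cover_action_closed:
  assumes "pair_graph X" "\<phi> \<in> carrier (graph_Aut X)" "\<sigma> \<in> Bij {0, 1}"
  shows "cover_action X (\<phi>, \<sigma>) \<in> carrier (graph_Aut (bipartite_double_cover X))"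
proof -
  interpret pair_graph X by fact
  let ?V = "pverts X" and ?f = "cover_action X (\<phi>, \<sigma>)"
  have B: "bij_betw \<phi> ?V ?V" "bij_betw \<sigma> {0, 1} {0, 1}"
    using assms(2,3) by (auto simp: carrier_graph_Aut Bij_def)
  have "bij_betw (map_prod \<phi> \<sigma>) (?V \<times> {0, 1}) (?V \<times> {0, 1})"
    using B by (rule bij_betw_map_prod)
  then have "bij_betw ?f (?V \<times> {0, 1}) (?V \<times> {0, 1})"
    by (rule bij_betw_cong[THEN iffD1, rotated]) (auto simp: cover_action_def)
  then have Bf: "?f \<in> Bij (?V \<times> {0, 1})"
    by (simp add: Bij_def cover_action_def)
  have E: "(\<phi> v, \<phi> w) \<in> parcs X \<longleftrightarrow> (v, w) \<in> parcs X" if "v \<in> ?V" "w \<in> ?V" for v w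
    using assms(2) that by (simp add: carrier_graph_Aut)
  show ?thesis
    using Bf Bij_01_cases[OF assms(3)] E
    by (auto simp: carrier_graph_Aut bipartite_double_cover_def cover_action_def
        dest: arcs_symmetric)
qed

lemma cover_action_hom:
  assumes "pair_graph X"
  shows "cover_action X \<in> hom (graph_Aut X \<times>\<times> BijGroup {0, 1})
    (graph_Aut (bipartite_double_cover X))"
proof -
  let ?V = "pverts X"
  have mult: "cover_action X (compose ?V \<phi> \<phi>', compose {0, 1} \<sigma> \<sigma>')
      = compose (?V \<times> {0, 1}) (cover_action X (\<phi>, \<sigma>)) (cover_action X (\<phi>', \<sigma>'))"
    if "\<phi>' \<in> Bij ?V" "\<sigma>' \<in> Bij {0, 1}" for \<phi> \<phi>' and \<sigma> \<sigma>' :: "nat \<Rightarrow> nat"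
    using Bij_imp_funcset[OF that(1)] Bij_imp_funcset[OF that(2)]
    by (auto simp: fun_eq_iff cover_action_def compose_def Pi_iff)
  have mA: "f \<otimes>\<^bsub>graph_Aut Y\<^esub> g = compose (pverts Y) f g"
    if "f \<in> carrier (graph_Aut Y)" "g \<in> carrier (graph_Aut Y)"
    for Y :: "'z pair_pre_digraph" and f g
    using that by (simp add: carrier_graph_Aut) (simp add: graph_Aut_def BijGroup_def)
  have pv: "pverts (bipartite_double_cover X) = ?V \<times> {0, 1}"
    by (simp add: bipartite_double_cover_def)
  have mB: "\<sigma> \<otimes>\<^bsub>BijGroup {0, 1}\<^esub> \<sigma>' = compose {0, 1} \<sigma> \<sigma>'"
    if "\<sigma> \<in> Bij {0, 1}" "\<sigma>' \<in> Bij {0, 1}" for \<sigma> \<sigma>' :: "nat \<Rightarrow> nat"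
    using that by (simp add: BijGroup_def)
  have cB: "carrier (BijGroup {0, 1::nat}) = Bij {0, 1}" by (simp add: BijGroup_def)
  have VB: "\<phi> \<in> Bij ?V" if "\<phi> \<in> carrier (graph_Aut X)" for \<phi>
    using that by (simp add: carrier_graph_Aut)
  show ?thesis
    unfolding hom_def
    using cover_action_closed[OF assms]
    by (auto simp: cB mB mA pv mult VB simp del: One_nat_def)
qed

lemma cover_action_inj:
  "inj_on (cover_action X) (carrier (graph_Aut X \<times>\<times> BijGroup {0, 1}))"
  if "pverts X \<noteq> {}"
proof (rule inj_onI, clarsimp)
  fix \<phi> \<sigma> \<phi>' \<sigma>'
  assume A: "\<phi> \<in> carrier (graph_Aut X)" "\<phi>' \<in> carrier (graph_Aut X)"
    and B: "\<sigma> \<in> carrier (BijGroup {0, Suc 0})" "\<sigma>' \<in> carrier (BijGroup {0, Suc 0})"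
    and eq: "cover_action X (\<phi>, \<sigma>) = cover_action X (\<phi>', \<sigma>')"
  have *: "\<phi> v = \<phi>' v \<and> \<sigma> i = \<sigma>' i" if "v \<in> pverts X" "i \<in> {0, 1}" for v i
    using fun_cong[OF eq, of "(v, i)"] that by (auto simp: cover_action_def)
  have "\<phi> = \<phi>'"
    by (rule extensionalityI[of _ "pverts X"]) (use A * in \<open>auto simp: carrier_graph_Aut Bij_def\<close>)
  moreover have "\<sigma> = \<sigma>'"
    by (rule extensionalityI[of _ "{0, 1}"]) (use B * that in \<open>auto simp: BijGroup_def Bij_def\<close>)
  ultimately show "\<phi> = \<phi>' \<and> \<sigma> = \<sigma>'" by simp
qed

end

theory Submission
  imports Defs "HOL-Algebra.Multiplicative_Group"
begin

text \<open>
  If \<open>f \<noteq> g\<close> are permutations of the vertices such that \<open>v \<sim> w\<close> iff \<open>f v \<sim> g w\<close>, then letting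
  \<open>f\<close> act on level \<open>0\<close> and \<open>g\<close> on level \<open>1\<close> gives an automorphism of the double cover outside
  \<open>Aut X \<times> S\<^sub>2\<close>. Both cases of the theorem provide a subgroup \<open>M\<close> (namely \<open>2K + H\<close> or \<open>2K\<close>)
  and a coset \<open>C = k + M \<noteq> M\<close> (namely \<open>K\<^sub>o + H\<close> or \<open>K\<^sub>o\<close>) such that \<open>S\<close> is a union of cosets of
  \<open>H\<close> away from \<open>C\<close>. Let \<open>f\<close> commute with translations by \<open>M\<close> and preserve the cosets of
  \<open>H\<close>, and put \<open>g v = f (v - k) + k\<close>. Then differences in \<open>C\<close> are unchanged and all others move
  within their coset of \<open>H\<close> without entering \<open>C\<close>. For \<open>a \<in> H\<close> with \<open>a \<noteq> 0\<close> and
  \<open>a \<notin> C\<close>, translating \<open>M\<close> by \<open>a\<close> (if \<open>a \<in> M\<close>) or exchanging \<open>M\<close> with \<open>M + a\<close> (otherwise)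
  is such an \<open>f\<close>, and it differs from \<open>g\<close> at \<open>k\<close>.
\<close>

section \<open>Instability from two permutations of the vertices\<close>

lemma unstable_if_distinct_level_permutations:
  assumes f: "bij_betw f (pverts X) (pverts X)" and g: "bij_betw g (pverts X) (pverts X)"
    and arcs: "\<And>v w. v \<in> pverts X \<Longrightarrow> w \<in> pverts X \<Longrightarrow>
      (f v, g w) \<in> parcs X \<longleftrightarrow> (v, w) \<in> parcs X"
    and u: "u \<in> pverts X" "f u \<noteq> g u"
  shows "unstable X"
proof -
  let ?V = "pverts X" and ?B = "bipartite_double_cover X"
  define F where "F = (\<lambda>(v, i) \<in> ?V \<times> {0, 1::nat}. (if i = 0 then f v else g v, i))"
  have F0: "F (v, 0) = (f v, 0)" and F1: "F (v, 1) = (g v, 1)" if "v \<in> ?V" for v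
    using that by (auto simp: F_def)
  have VB: "pverts ?B = ?V \<times> {0, 1}"
    by (simp add: bipartite_double_cover_def)
  have "bij_betw F (?V \<times> {0, 1}) (?V \<times> {0, 1})"
  proof (rule bij_betw_imageI)
    show "inj_on F (?V \<times> {0, 1})"
      using bij_betw_imp_inj_on[OF f] bij_betw_imp_inj_on[OF g]
      by (auto simp: inj_on_def F_def)
    have "F ` (?V \<times> {0, 1}) = (\<lambda>v. (f v, 0)) ` ?V \<union> (\<lambda>v. (g v, 1)) ` ?V"
      using F0 F1 by (force simp: image_iff)
    also have "\<dots> = f ` ?V \<times> {0} \<union> g ` ?V \<times> {1}" by auto
    also have "\<dots> = ?V \<times> {0, 1}"
      using bij_betw_imp_surj_on[OF f] bij_betw_imp_surj_on[OF g] by auto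
    finally show "F ` (?V \<times> {0, 1}) = ?V \<times> {0, 1}" .
  qed
  then have "F \<in> Bij (pverts ?B)"
    by (simp add: Bij_def VB F_def)
  moreover have "(F x, F y) \<in> parcs ?B \<longleftrightarrow> (x, y) \<in> parcs ?B"
    if "x \<in> pverts ?B" "y \<in> pverts ?B" for x y
    using that arcs by (auto simp: VB F_def bipartite_double_cover_def)
  ultimately have "F \<in> carrier (graph_Aut ?B)"
    by (simp add: carrier_graph_Aut)
  \<comment> \<open>An element of \<open>Aut X\<close> times \<open>S_2\<close> moves first
    coordinates in the same way on both levels; at \<open>u\<close> this fails for
    \<open>F\<close>.\<close>
  moreover have "F \<noteq> cover_action X (\<phi>, \<sigma>)" for \<phi> \<sigma>
  proof
    assume "F = cover_action X (\<phi>, \<sigma>)"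
    then have "(f u, 0) = (\<phi> u, \<sigma> 0)" "(g u, 1) = (\<phi> u, \<sigma> 1)"
      using F0[OF u(1)] F1[OF u(1)] u(1) by (simp_all add: cover_action_def)
    with u(2) show False by simp
  qed
  ultimately show ?thesis
    unfolding unstable_def by (metis imageE surj_pair)
qed

section \<open>Twisting Cayley graphs of abelian groups\<close>

context comm_group
begin

lemma mult_inv_eq_iff:
  assumes "x \<in> carrier G" "y \<in> carrier G" "z \<in> carrier G"
  shows "x \<otimes> inv y = z \<longleftrightarrow> x = y \<otimes> z"
  using assms inv_solve_right'[of z x y] m_comm[of y z] by auto

lemma in_l_coset_iff:
  assumes "subgroup M G" "k \<in> carrier G" "x \<in> carrier G"
  shows "x \<in> k <# M \<longleftrightarrow> x \<otimes> inv k \<in> M"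
proof
  assume "x \<in> k <# M"
  then show "x \<otimes> inv k \<in> M"
    using assms subgroup.subset[OF assms(1)] by (auto simp: l_coset_def mult_inv_eq_iff)
       (metis mult_inv_eq_iff m_closed subsetD)
next
  assume "x \<otimes> inv k \<in> M"
  moreover have "x = k \<otimes> (x \<otimes> inv k)"
    using assms mult_inv_eq_iff[of x k "x \<otimes> inv k"] by simp
  ultimately show "x \<in> k <# M" by (auto simp: l_coset_def)
qed

text \<open>The second permutation \<open>g\<close> is \<open>f\<close> conjugated by the
  translation by \<open>k\<close>. Here \<open>fM\<close> is what preserves differences in
  \<open>k <# M\<close>, \<open>fH\<close> confines the change of all others to \<open>H\<close>,
  and \<open>fk\<close> separates \<open>f\<close> from \<open>g\<close> at \<open>k\<close>,
  because \<open>g k\<close> is \<open>f \<one> \<otimes> k\<close>.\<close>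

lemma unstable_Cay_if_twist:
  assumes M: "subgroup M G" and k: "k \<in> carrier G" and H: "subgroup H G"
    and S: "\<And>s h. s \<in> S \<Longrightarrow> s \<notin> k <# M \<Longrightarrow> h \<in> H \<Longrightarrow> s \<otimes> h \<in> S \<union> (k <# M)"
    and f: "bij_betw f (carrier G) (carrier G)"
    and fH: "\<And>v. v \<in> carrier G \<Longrightarrow> f v \<otimes> inv v \<in> H"
    and fM: "\<And>v m. v \<in> carrier G \<Longrightarrow> m \<in> M \<Longrightarrow> f (v \<otimes> m) = f v \<otimes> m"
    and fk: "f k \<noteq> f \<one> \<otimes> k"
  shows "unstable (Cay G S)"
proof -
  note Mc = subgroup.mem_carrier[OF M] and Hc = subgroup.mem_carrier[OF H]
  have fc [simp]: "f v \<in> carrier G" if "v \<in> carrier G" for v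
    using bij_betwE[OF f] that by blast
  define g where "g v = f (v \<otimes> inv k) \<otimes> k" for v
  have gc [simp]: "g v \<in> carrier G" if "v \<in> carrier G" for v
    using that k by (simp add: g_def)
  have tr: "bij_betw (\<lambda>v. v \<otimes> c) (carrier G) (carrier G)" if "c \<in> carrier G" for c
    using that by (intro bij_betwI[of _ _ _ "\<lambda>v. v \<otimes> inv c"]) (auto simp: m_assoc)
  have "bij_betw ((\<lambda>v. v \<otimes> k) \<circ> f \<circ> (\<lambda>v. v \<otimes> inv k)) (carrier G) (carrier G)"
    using tr[OF k] tr[of "inv k"] f k by (intro bij_betw_trans) auto
  then have g: "bij_betw g (carrier G) (carrier G)"
    by (rule bij_betw_cong[THEN iffD1, rotated]) (simp add: g_def)
  \<comment> \<open>The shift by \<open>inv k\<close> inside \<open>g\<close> turns \<open>c\<close>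
    into an element \<open>m\<close> of \<open>M\<close>, which can be pulled out of
    \<open>f\<close>.\<close>
  have g_coset: "g (v \<otimes> c) = f v \<otimes> c" if vc: "v \<in> carrier G" "c \<in> k <# M" for v c
  proof -
    obtain m where m: "m \<in> M" "c = k \<otimes> m" using vc(2) by (auto simp: l_coset_def)
    then have "v \<otimes> c \<otimes> inv k = v \<otimes> m"
      using vc(1) k Mc[OF m(1)] by (subst mult_inv_eq_iff) (simp_all add: m_ac)
    then have "g (v \<otimes> c) = f v \<otimes> m \<otimes> k" using vc(1) m(1) by (simp add: g_def fM)
    then show ?thesis
      using vc(1) k m(2) Mc[OF m(1)] by (simp add: m_ac)
  qed
  \<comment> \<open>Since \<open>f\<close> moves every point by an element of \<open>H\<close>, so
    does its conjugate \<open>g\<close>.\<close>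
  have gH: "\<exists>h\<in>H. g w \<otimes> inv (f v) = w \<otimes> inv v \<otimes> h"
    if vw: "v \<in> carrier G" "w \<in> carrier G" for v w
  proof -
    obtain a where a: "a \<in> H" "f v = v \<otimes> a"
      using fH[OF vw(1)] vw mult_inv_eq_iff[of "f v" v "f v \<otimes> inv v"] by auto
    obtain b where b: "b \<in> H" "f (w \<otimes> inv k) = w \<otimes> inv k \<otimes> b"
      using fH[of "w \<otimes> inv k"] vw k
        mult_inv_eq_iff[of "f (w \<otimes> inv k)" "w \<otimes> inv k" "f (w \<otimes> inv k) \<otimes> inv (w \<otimes> inv k)"]
      by auto
    have "inv k \<otimes> (k \<otimes> b) = b"
      using k Hc[OF b(1)] by (simp flip: m_assoc)
    then have "g w = w \<otimes> b"
      using vw k Hc[OF b(1)] by (simp add: g_def b(2) m_assoc m_comm[of b k])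
    then have "g w \<otimes> inv (f v) = w \<otimes> inv v \<otimes> (b \<otimes> inv a)"
      using vw Hc[OF a(1)] Hc[OF b(1)] by (simp add: a(2) inv_mult m_ac)
    moreover have "b \<otimes> inv a \<in> H"
      using a b H by (simp add: subgroup.m_closed subgroup.m_inv_closed)
    ultimately show ?thesis by blast
  qed
  have diff: "g w \<otimes> inv (f v) \<in> S \<longleftrightarrow> w \<otimes> inv v \<in> S"
    if vw: "v \<in> carrier G" "w \<in> carrier G" for v w
  proof -
    let ?x = "w \<otimes> inv v" and ?y = "g w \<otimes> inv (f v)"
    have y_eq_x: "?y = ?x" if "?x \<in> k <# M"
    proof -
      have "w = v \<otimes> ?x" using vw mult_inv_eq_iff[of w v ?x] by simp
      then have "g w = f v \<otimes> ?x" using g_coset[OF vw(1) that] by simp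
      then show ?thesis using vw by (simp add: mult_inv_eq_iff)
    qed
    \<comment> \<open>Injectivity of \<open>g\<close> shows that no difference enters the coset from
      outside.\<close>
    have x_eq_y: "?y = ?x" if "?y \<in> k <# M"
    proof -
      have "g w = f v \<otimes> ?y" using vw mult_inv_eq_iff[of "g w" "f v" ?y] by simp
      also have "\<dots> = g (v \<otimes> ?y)" using g_coset[OF vw(1) that] by simp
      finally have "w = v \<otimes> ?y"
        using bij_betw_imp_inj_on[OF g] vw by (auto dest: inj_onD)
      then show ?thesis using vw mult_inv_eq_iff[of w v ?y] by simp
    qed
    \<comment> \<open>Away from the coset, the two differences lie in one coset of \<open>H\<close>,
      so \<open>S\<close> can be applied in both directions, with \<open>h\<close> and with
      \<open>inv h\<close>.\<close>
    obtain h where h: "h \<in> H" "?y = ?x \<otimes> h" using gH[OF vw] by blast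
    then have "?x = ?y \<otimes> inv h"
      using vw Hc[OF h(1)] by (simp add: m_assoc)
    moreover have "inv h \<in> H" using h(1) H by (simp add: subgroup.m_inv_closed)
    ultimately show ?thesis
      using S[of ?x h] S[of ?y "inv h"] h x_eq_y y_eq_x by (metis UnE)
  qed
  show ?thesis
  proof (rule unstable_if_distinct_level_permutations)
    show "bij_betw f (pverts (Cay G S)) (pverts (Cay G S))"
      "bij_betw g (pverts (Cay G S)) (pverts (Cay G S))"
      using f g by (simp_all add: Cay_def)
    show "(f v, g w) \<in> parcs (Cay G S) \<longleftrightarrow> (v, w) \<in> parcs (Cay G S)"
      if "v \<in> pverts (Cay G S)" "w \<in> pverts (Cay G S)" for v w
      using that diff by (simp add: Cay_def)
    show "k \<in> pverts (Cay G S)" "f k \<noteq> g k"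
      using k fk by (simp_all add: Cay_def g_def)
  qed
qed

text \<open>Both choices of \<open>f\<close> fix \<open>k\<close> but send \<open>\<one>\<close> to
  \<open>a\<close>, and this distinguishes \<open>f\<close> from its conjugate.\<close>

lemma unstable_Cay_if_coset:
  assumes M: "subgroup M G" and k: "k \<in> carrier G" "k \<notin> M" and H: "subgroup H G"
    and S: "\<And>s h. s \<in> S \<Longrightarrow> s \<notin> k <# M \<Longrightarrow> h \<in> H \<Longrightarrow> s \<otimes> h \<in> S \<union> (k <# M)"
    and a: "a \<in> H" "a \<noteq> \<one>" "a \<notin> k <# M"
  shows "unstable (Cay G S)"
proof -
  note Mc = subgroup.mem_carrier[OF M]
  have ac: "a \<in> carrier G" using subgroup.mem_carrier[OF H a(1)] .
  have one: "\<one> \<in> M" using M by (rule subgroup.one_closed)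
  have Hinv: "inv a \<in> H" "\<one> \<in> H"
    using a(1) H by (auto intro: subgroup.m_inv_closed subgroup.one_closed)
  have Mm: "v \<otimes> m \<in> M \<longleftrightarrow> v \<in> M" if "v \<in> carrier G" "m \<in> M" for v m
  proof
    assume "v \<otimes> m \<in> M"
    then have "v \<otimes> m \<otimes> inv m \<in> M" using that M by (simp add: subgroup.m_closed subgroup.m_inv_closed)
    then show "v \<in> M" using that Mc by (simp add: m_assoc)
  qed (use that M in \<open>simp add: subgroup.m_closed\<close>)
  show ?thesis
  proof (cases "a \<in> M")
    case True
    have iM: "inv a \<in> M" using True M by (simp add: subgroup.m_inv_closed)
    define f where "f v = (if v \<in> M then v \<otimes> a else v)" for v
    show ?thesis
    proof (rule unstable_Cay_if_twist[OF M k(1) H S, where f = f])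
      show "bij_betw f (carrier G) (carrier G)"
        by (rule bij_betwI[of _ _ _ "\<lambda>v. if v \<in> M then v \<otimes> inv a else v"])
          (auto simp: f_def ac Mm True iM m_assoc)
      show "f v \<otimes> inv v \<in> H" if "v \<in> carrier G" for v
        using that a(1) Hinv ac by (simp add: f_def mult_inv_eq_iff) (simp add: m_ac)
      show "f (v \<otimes> m) = f v \<otimes> m" if "v \<in> carrier G" "m \<in> M" for v m
      proof -
        have "v \<otimes> m \<otimes> a = v \<otimes> a \<otimes> m"
          using that ac Mc[OF that(2)] by (simp add: m_ac)
        then show ?thesis using Mm[OF that] by (simp add: f_def)
      qed
      show "f k \<noteq> f \<one> \<otimes> k"
        using k ac one a(2) by (simp add: f_def r_cancel_one')
    qed
  next
    case False
    define f where "f v = (if v \<in> M then v \<otimes> a else if v \<otimes> inv a \<in> M then v \<otimes> inv a else v)" for v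
    \<comment> \<open>The cosets of \<open>\<one>\<close> and \<open>a\<close> are disjoint, so
      exchanging them is an involution.\<close>
    have va: "v \<otimes> a \<notin> M" if "v \<in> M" for v
      using False Mm[OF ac that] m_comm[OF ac Mc[OF that]] by simp
    show ?thesis
    proof (rule unstable_Cay_if_twist[OF M k(1) H S, where f = f])
      have "f (f v) = v" if "v \<in> carrier G" for v
        using that ac va by (simp add: f_def m_assoc)
      moreover have "f v \<in> carrier G" if "v \<in> carrier G" for v
        using that ac by (simp add: f_def)
      ultimately show "bij_betw f (carrier G) (carrier G)"
        by (intro bij_betwI[of _ _ _ f]) auto
      show "f v \<otimes> inv v \<in> H" if "v \<in> carrier G" for v
      proof -
        have "v \<otimes> b \<otimes> inv v = b" if "b \<in> carrier G" for b
          using \<open>v \<in> carrier G\<close> that by (simp add: mult_inv_eq_iff)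
        then show ?thesis
          using \<open>v \<in> carrier G\<close> a(1) Hinv ac by (simp add: f_def)
      qed
      show "f (v \<otimes> m) = f v \<otimes> m" if "v \<in> carrier G" "m \<in> M" for v m
      proof -
        have "v \<otimes> m \<otimes> inv a = v \<otimes> inv a \<otimes> m"
          using that ac Mc[OF that(2)] by (simp add: m_ac)
        then show ?thesis
          using that ac Mm[OF that] Mm[of "v \<otimes> inv a" m] Mc[OF that(2)]
          by (simp add: f_def) (simp add: m_ac)
      qed
      \<comment> \<open>If \<open>k\<close> were in the coset \<open>a <# M\<close>, then
        \<open>f\<close> would move it; the choice of \<open>a\<close> outside \<open>k <# M\<close>
        excludes this.\<close>
      have "k \<otimes> inv a \<notin> M"
      proof
        assume "k \<otimes> inv a \<in> M"
        then have "inv (k \<otimes> inv a) \<in> M" using M by (simp add: subgroup.m_inv_closed)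
        then have "a \<otimes> inv k \<in> M" using k ac by (simp add: inv_mult m_comm)
        then show False using a(3) in_l_coset_iff[OF M k(1) ac] by simp
      qed
      then show "f k \<noteq> f \<one> \<otimes> k"
        using k ac one a(2) by (simp add: f_def r_cancel_one')
    qed
  qed
qed

end

section \<open>Cyclic groups\<close>

text \<open>The power of \<open>y\<close> with the least positive exponent \<open>d\<close> that
  lands in \<open>K\<close> is a generator, by division with remainder. If no such exponent exists,
  \<open>K\<close> is trivial, because inversion turns negative exponents into positive
  ones.\<close>

lemma (in group) subgroup_of_cyclic_group:
  assumes "cyclic_group G" "subgroup K G"
  obtains x where "x \<in> K" "K = range (\<lambda>i::int. x [^] i)"
proof -
  obtain y where y: "y \<in> carrier G" "carrier G = range (\<lambda>i::int. y [^] i)"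
    using assms(1) by (auto simp: cyclic_group)
  interpret K: subgroup K G by fact
  show ?thesis
  proof (cases "\<exists>d>0. y [^] int d \<in> K")
    case False
    have "y [^] i = \<one>" if "y [^] i \<in> K" for i :: int
    proof -
      have "y [^] (- i) \<in> K" using that y(1) by (simp add: int_pow_neg)
      then have "y [^] int (nat \<bar>i\<bar>) \<in> K" using that by (metis abs_ge_zero abs_if nat_0_le)
      then have "\<not> nat \<bar>i\<bar> > 0" using False by (metis (no_types))
      then show ?thesis by simp
    qed
    then have "z = \<one>" if "z \<in> K" for z
      using y(2) K.subset that by (metis imageE subsetD)
    then have "K = {\<one>}" using K.one_closed by blast
    then show ?thesis by (intro that[of \<one>]) (simp_all add: int_pow_one)
  next
    case True
    define d where "d = (LEAST d. d > 0 \<and> y [^] int d \<in> K)"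
    have d: "d > 0" "y [^] int d \<in> K"
      using LeastI_ex[OF True] by (auto simp: d_def)
    have pw: "(y [^] int d) [^] i \<in> K" for i :: int
      using d(2) by (rule subgroup_int_pow_closed[OF assms(2)])
    have "x \<in> range (\<lambda>i::int. (y [^] int d) [^] i)" if x: "x \<in> K" for x
    proof -
      obtain i :: int where i: "x = y [^] i" using x y(2) K.subset by auto
      define r where "r = nat (i mod int d)"
      have r: "int r = i - int d * (i div int d)" "r < d"
        using d(1) by (auto simp: r_def minus_mult_div_eq_mod nat_less_iff)
      have "y [^] (int r) = x \<otimes> inv ((y [^] int d) [^] (i div int d))"
        using y(1) by (simp add: r i int_pow_diff int_pow_pow)
      then have "y [^] (int r) \<in> K" using x pw by simp
      then have "r = 0" using r(2) not_less_Least[of r "\<lambda>d. d > 0 \<and> y [^] int d \<in> K"]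
        unfolding d_def by (metis gr0I)
      then have "x = (y [^] int d) [^] (i div int d)"
        using r(1) i y(1) by (simp add: int_pow_pow)
      then show ?thesis by blast
    qed
    then show ?thesis using d(2) pw by (intro that[of "y [^] int d"]) auto
  qed
qed

lemma cyclic_integer_mod_group: "cyclic_group (integer_mod_group n)"
proof -
  interpret group "integer_mod_group n" by simp
  \<comment> \<open>The reduction matters for \<open>n = 1\<close>, where the generator is
    \<open>0\<close>; for \<open>n = 0\<close> it leaves \<open>1\<close> unchanged.\<close>
  have one: "1 mod int n \<in> carrier (integer_mod_group n)"
    by (simp add: carrier_integer_mod_group)
  moreover have "carrier (integer_mod_group n)
      = range (\<lambda>i::int. (1 mod int n) [^]\<^bsub>integer_mod_group n\<^esub> i)"
  proof
    show "range (\<lambda>i::int. (1 mod int n) [^]\<^bsub>integer_mod_group n\<^esub> i) \<subseteq> carrier (integer_mod_group n)"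
      using one by auto
    show "carrier (integer_mod_group n) \<subseteq> range (\<lambda>i::int. (1 mod int n) [^]\<^bsub>integer_mod_group n\<^esub> i)"
    proof
      fix x assume "x \<in> carrier (integer_mod_group n)"
      then have "x = (1 mod int n) [^]\<^bsub>integer_mod_group n\<^esub> x"
        by (simp add: int_pow_integer_mod_group mod_mult_right_eq carrier_integer_mod_group
            split: if_splits)
      then show "x \<in> range (\<lambda>i::int. (1 mod int n) [^]\<^bsub>integer_mod_group n\<^esub> i)" by blast
    qed
  qed
  ultimately show ?thesis unfolding cyclic_group by blast
qed

section \<open>The nondoubles of a cyclic group of even order\<close>

context comm_group
begin

lemma subgroup_squares:
  assumes "subgroup K G"
  shows "subgroup {k [^] (2::nat) | k. k \<in> K} G"
proof -
  interpret K: subgroup K G by fact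
  show ?thesis
  proof
    show "{k [^] (2::nat) | k. k \<in> K} \<subseteq> carrier G" by auto
    show "\<one> \<in> {k [^] (2::nat) | k. k \<in> K}" by (auto intro!: exI[of _ "\<one>"])
  next
    fix x y assume "x \<in> {k [^] (2::nat) | k. k \<in> K}" "y \<in> {k [^] (2::nat) | k. k \<in> K}"
    then obtain a b where "a \<in> K" "b \<in> K" "x = a [^] (2::nat)" "y = b [^] (2::nat)" by blast
    then show "x \<otimes> y \<in> {k [^] (2::nat) | k. k \<in> K}"
      by (intro CollectI exI[of _ "a \<otimes> b"]) (simp add: nat_pow_distrib)
  next
    fix x assume "x \<in> {k [^] (2::nat) | k. k \<in> K}"
    then obtain a where "a \<in> K" "x = a [^] (2::nat)" by blast
    then show "inv x \<in> {k [^] (2::nat) | k. k \<in> K}"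
      by (intro CollectI exI[of _ "inv a"]) (simp add: nat_pow_inv)
  qed
qed

text \<open>
  Since \<open>card K\<close> is even (it is \<open>0\<close> for infinite \<open>K\<close>), the parity of the exponent of a power of
  the generator \<open>x\<close> is well defined.
\<close>

lemma nondoubles_cyclic:
  assumes K: "subgroup K G" "even (card K)"
    and x: "x \<in> K" "K = range (\<lambda>i::int. x [^] i)"
  defines "D \<equiv> {k [^] (2::nat) | k. k \<in> K}"
  shows "x \<notin> D" and "nondoubles G K = x <# D"
    and "4 dvd card K \<Longrightarrow> h \<in> K \<Longrightarrow> h \<otimes> h = \<one> \<Longrightarrow> h \<in> D"
proof -
  interpret K: subgroup K G by fact
  have xc: "x \<in> carrier G" using x(1) by simp
  have "generate G {x} = K" using generate_pow[OF xc] x(2) by auto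
  then have ord: "ord x = card K" using generate_pow_card[OF xc] by simp
  have D_iff: "x [^] i \<in> D \<longleftrightarrow> even i" for i :: int
  proof
    assume "x [^] i \<in> D"
    then obtain j :: int where "x [^] i = (x [^] j) [^] (2::nat)"
      unfolding D_def using x(2) by auto
    also have "\<dots> = x [^] (j * 2)" using xc by (simp add: int_pow_pow flip: int_pow_int)
    finally have "x [^] (i - j * 2) = \<one>" using xc by (simp add: int_pow_diff)
    then have "int (card K) dvd i - j * 2" using int_pow_eq_id[OF xc] ord by simp
    moreover have "2 dvd int (card K)" using K(2) by simp
    ultimately have "2 dvd i - j * 2" by (rule dvd_trans[rotated])
    then show "even i" by simp
  next
    assume "even i"
    then obtain j where "i = j * 2" by (metis dvdE mult.commute)
    then have "x [^] i = (x [^] j) [^] (2::nat)"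
      using xc by (simp add: int_pow_pow flip: int_pow_int)
    then show "x [^] i \<in> D" unfolding D_def using x(2) by blast
  qed
  show "x \<notin> D" using D_iff[of 1] xc by simp
  have D: "subgroup D G" unfolding D_def using K(1) by (rule subgroup_squares)
  \<comment> \<open>As \<open>D\<close> consists of the even powers, its coset by \<open>x\<close>
    consists of the odd ones and so is the complement of \<open>D\<close> in
    \<open>K\<close>.\<close>
  have coset: "x [^] i \<in> x <# D \<longleftrightarrow> odd i" for i :: int
    using in_l_coset_iff[OF D xc, of "x [^] i"] D_iff[of "i - 1"] xc
    by (simp add: int_pow_diff)
  have "x <# D \<subseteq> K" unfolding l_coset_def D_def using x(1) by (auto simp: K.m_closed numeral_2_eq_2)
  then show "nondoubles G K = x <# D"
    unfolding nondoubles_def D_def[symmetric] using coset D_iff x(2) by auto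
  assume c: "4 dvd card K" and h: "h \<in> K" "h \<otimes> h = \<one>"
  \<comment> \<open>Because \<open>h\<close> is its own inverse, \<open>card K\<close> divides
    \<open>2 * i\<close>; divisibility by 4 then makes \<open>i\<close> even.\<close>
  obtain i :: int where i: "h = x [^] i" using h(1) x(2) by auto
  have "x [^] (i + i) = \<one>" using h(2) xc i by (metis int_pow_mult)
  then have "int (card K) dvd i + i" using int_pow_eq_id[OF xc] ord by simp
  moreover have "4 dvd int (card K)" using c by presburger
  ultimately have "4 dvd i + i" by (rule dvd_trans[rotated])
  then show "h \<in> D" using D_iff i by presburger
qed

text \<open>This supplies the shift \<open>a\<close>. The coset is disjoint from \<open>D\<close>,
  and products of two of its elements lie in \<open>D\<close>. So a nontrivial \<open>h\<close> of
  \<open>H\<close> works if it is outside the coset, and otherwise its square works unless that is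
  \<open>\<one>\<close>. In the remaining case assumption \<open>2\<close> gives a third element
  \<open>h'\<close> of \<open>H\<close>, and one of \<open>h'\<close> and
  \<open>h' \<otimes> h\<close> is outside the coset.\<close>

lemma subgroup_not_within_coset:
  assumes D: "subgroup D G" and H: "subgroup H G" "H \<noteq> {\<one>}"
    and x: "x \<in> carrier G" "x \<notin> D" "x \<otimes> x \<in> D"
    and 2: "card H \<noteq> 2 \<or> (\<forall>h \<in> x <# D. h \<otimes> h = \<one> \<longrightarrow> h \<in> D)"
  obtains a where "a \<in> H" "a \<noteq> \<one>" "a \<notin> x <# D"
proof -
  interpret H: subgroup H G by fact
  interpret D: subgroup D G by fact
  have DC: "c \<notin> x <# D" if "c \<in> D" for c
  proof
    assume "c \<in> x <# D"
    then have "c \<otimes> inv x \<in> D" using in_l_coset_iff[OF D x(1)] that by simp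
    then have "inv c \<otimes> (c \<otimes> inv x) \<in> D" using that by simp
    then have "inv x \<in> D" using that x by (simp flip: m_assoc)
    then show False using x D.m_inv_closed by fastforce
  qed
  have CC: "c \<otimes> d \<in> D" if cd: "c \<in> x <# D" "d \<in> x <# D" for c d
  proof -
    obtain m m' where m: "m \<in> D" "m' \<in> D" "c = x \<otimes> m" "d = x \<otimes> m'"
      using cd by (auto simp: l_coset_def)
    then have "c \<otimes> d = (x \<otimes> x) \<otimes> (m \<otimes> m')" using x by (simp add: m_ac)
    then show ?thesis using m x by simp
  qed
  obtain h where h: "h \<in> H" "h \<noteq> \<one>" using H(2) H.one_closed by blast
  show ?thesis
  proof (cases "h \<in> x <# D \<and> h \<otimes> h = \<one>")
    case True
    then have "card H \<noteq> 2" using 2 DC by blast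
    moreover have "card {\<one>, h} = 2" using h by simp
    ultimately have "H \<noteq> {\<one>, h}" by metis
    then obtain h' where h': "h' \<in> H" "h' \<noteq> \<one>" "h' \<noteq> h" using h H.one_closed by blast
    have "h' \<otimes> h \<noteq> \<one>"
      using h h' True right_cancel[of h h' h] by auto
    then show ?thesis
      using that[of h'] that[of "h' \<otimes> h"] h h' True CC DC by (metis H.m_closed)
  next
    case False
    then show ?thesis
      using that[of h] that[of "h \<otimes> h"] h CC DC by (metis H.m_closed)
  qed
qed

end

section \<open>The two cases for circulant graphs\<close>

theorem theorem3p2:
  fixes n :: nat and S H K :: "int set"
  assumes "n > 0"
    and "connection_set (integer_mod_group n) S"
    and "subgroup H (integer_mod_group n)" and "H \<noteq> {\<one>\<^bsub>integer_mod_group n\<^esub>}"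
    and "subgroup K (integer_mod_group n)" and "K \<noteq> {\<one>\<^bsub>integer_mod_group n\<^esub>}"
    and "even (card K)"
    and "(S <#>\<^bsub>integer_mod_group n\<^esub> H
            \<subseteq> S \<union> (nondoubles (integer_mod_group n) K <#>\<^bsub>integer_mod_group n\<^esub> H)
          \<and> H \<inter> nondoubles (integer_mod_group n) K = {})
       \<or> ((S - nondoubles (integer_mod_group n) K) <#>\<^bsub>integer_mod_group n\<^esub> H
            \<subseteq> S \<union> nondoubles (integer_mod_group n) K
          \<and> (card H \<noteq> 2 \<or> 4 dvd card K))"
  shows "unstable (Cay (integer_mod_group n) S)"
proof -
  define G where "G = integer_mod_group n"
  interpret comm_group G unfolding G_def by simp
  have H: "subgroup H G" "H \<noteq> {\<one>\<^bsub>G\<^esub>}" and K: "subgroup K G"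
    using assms by (auto simp: G_def)
  interpret H: subgroup H G by fact
  interpret K: subgroup K G by fact
  \<comment> \<open>A generator of \<open>K\<close> serves as the representative \<open>k\<close> of
    the coset in both cases.\<close>
  obtain x where x: "x \<in> K" "K = range (\<lambda>i::int. x [^]\<^bsub>G\<^esub> i)"
    using subgroup_of_cyclic_group[OF _ K] cyclic_integer_mod_group unfolding G_def by blast
  define D where "D = {k [^]\<^bsub>G\<^esub> (2::nat) | k. k \<in> K}"
  note nd = nondoubles_cyclic[OF K assms(7) x, folded D_def]
  have D: "subgroup D G" unfolding D_def using K by (rule subgroup_squares)
  interpret D: subgroup D G by fact
  have xc: "x \<in> carrier G" using x(1) by simp
  have "x [^]\<^bsub>G\<^esub> (2::nat) \<in> D" using x(1) D_def by blast
  then have xx: "x \<otimes>\<^bsub>G\<^esub> x \<in> D" using xc by (simp add: numeral_2_eq_2)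
  have DK: "x <#\<^bsub>G\<^esub> D \<subseteq> K" using nd(2) by (auto simp: nondoubles_def)
  consider
    (1) "S <#>\<^bsub>G\<^esub> H \<subseteq> S \<union> ((x <#\<^bsub>G\<^esub> D) <#>\<^bsub>G\<^esub> H)" "H \<inter> (x <#\<^bsub>G\<^esub> D) = {}"
  | (2) "(S - (x <#\<^bsub>G\<^esub> D)) <#>\<^bsub>G\<^esub> H \<subseteq> S \<union> (x <#\<^bsub>G\<^esub> D)" "card H \<noteq> 2 \<or> 4 dvd card K"
    using assms(8) unfolding G_def[symmetric] nd(2) by blast
  then have "unstable (Cay G S)"
  proof cases
    case 1
    define M where "M = D <#>\<^bsub>G\<^esub> H"
    have M: "subgroup M G"
      unfolding M_def by (rule mult_subgroups[OF D H(1)])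
    have HM: "H \<subseteq> M"
    proof
      fix h assume "h \<in> H"
      moreover from this have "h = \<one>\<^bsub>G\<^esub> \<otimes>\<^bsub>G\<^esub> h" by simp
      ultimately show "h \<in> M" unfolding M_def set_mult_def using D.one_closed by blast
    qed
    have C: "(x <#\<^bsub>G\<^esub> D) <#>\<^bsub>G\<^esub> H = x <#\<^bsub>G\<^esub> M"
      unfolding M_def by (rule setmult_lcos_assoc) (use D.subset H.subset xc in auto)
    \<comment> \<open>Writing \<open>x\<close> as a sum of some \<open>d\<close> in \<open>D\<close>
      and \<open>h\<close> in \<open>H\<close> would put \<open>h\<close> into the coset
      \<open>x <# D\<close>, which \<open>H\<close> avoids.\<close>
    have xM: "x \<notin> M"
    proof
      assume "x \<in> M"
      then obtain d h where dh: "d \<in> D" "h \<in> H" "x = d \<otimes>\<^bsub>G\<^esub> h" by (auto simp: M_def set_mult_def)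
      then have "h = x \<otimes>\<^bsub>G\<^esub> inv\<^bsub>G\<^esub> d"
        using mult_inv_eq_iff[of x d h] by simp
      then have "h \<in> x <#\<^bsub>G\<^esub> D" using dh unfolding l_coset_def by blast
      with 1(2) dh(2) show False by blast
    qed
    obtain a where a: "a \<in> H" "a \<noteq> \<one>\<^bsub>G\<^esub>" using H(2) H.one_closed by blast
    \<comment> \<open>Any nontrivial \<open>a\<close> in \<open>H\<close> works: it lies in
      \<open>M\<close>, hence not in another coset of \<open>M\<close>.\<close>
    have "a \<notin> x <#\<^bsub>G\<^esub> M"
    proof
      assume "a \<in> x <#\<^bsub>G\<^esub> M"
      then have "inv\<^bsub>G\<^esub> (a \<otimes>\<^bsub>G\<^esub> inv\<^bsub>G\<^esub> x) \<in> M"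
        using in_l_coset_iff[OF M xc] a(1) M by (simp add: subgroup.m_inv_closed)
      then have "inv\<^bsub>G\<^esub> (a \<otimes>\<^bsub>G\<^esub> inv\<^bsub>G\<^esub> x) \<otimes>\<^bsub>G\<^esub> a \<in> M"
        using a(1) HM M by (auto intro: subgroup.m_closed)
      then show False using xM a(1) xc by (simp add: inv_mult m_comm[of _ x] m_assoc)
    qed
    then show ?thesis
      using unstable_Cay_if_coset[OF M xc xM H(1) _ a, of S] 1(1) C
      by (auto simp: set_mult_def)
  next
    case 2
    \<comment> \<open>If 4 divides \<open>card K\<close>, all \<open>h\<close> in \<open>K\<close>
      with \<open>h \<otimes> h = \<one>\<close> are doubles, so none of them lies in the
      coset.\<close>
    obtain a where a: "a \<in> H" "a \<noteq> \<one>\<^bsub>G\<^esub>" "a \<notin> x <#\<^bsub>G\<^esub> D"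
      using subgroup_not_within_coset[OF D H xc nd(1) xx] 2(2) nd(3) DK by blast
    show ?thesis
      using unstable_Cay_if_coset[OF D xc nd(1) H(1) _ a, of S] 2(1)
      by (auto simp: set_mult_def)
  qed
  then show ?thesis by (simp add: G_def)
qed

end
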